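(* Let $k\in\mathbb{N}_0$, $a\in\mathbb{C}\setminus\{0,-1,-2,\ldots\}$, and let $z,s\in\mathbb{C}$ be such that the series defining $H_k(z,s,a)$ converges absolutely (that is, $|z|<1$, or $|z|=1$ and $\operatorname{Re}(s)>3$). Then $$H_k(z,s,a)=\left(\alpha_kD^2+\beta_kD+1\right)\Phi(z,s,a).$$
   Context: $\mathbb{N}_0=\{0,1,2,\ldots\}$. $\alpha_k=\frac32 4^k$, $\beta_k=\frac32 2^k$, and the $k$-augmented centered triangular numbers are given by $A(r+1,k)=\alpha_k r^2+\beta_k r+1$ for integers $r\ge0$. Complex powers are principal: $(r+a)^{-s}=\exp\{-s\operatorname{Log}(r+a)\}$, $-\pi<\operatorname{Arg}\le\pi$. The Hurwitz--Lerch transcendent is $\Phi(z,s,a)=\sum_{r=0}^{\infty}\frac{z^r}{(r+a)^s}$, and $H_k(z,s,a)=\sum_{r=0}^{\infty}\frac{A(r+1,k)z^r}{(r+a)^s}$. $D=z\frac{d}{dz}$ is the Euler operator; for $|z|<1$, $D^j\Phi(z,s,a)$ is the result of applying $D$ $j$ times to $\Phi$ in the variable $z$, and at points $|z|=1$ the symbol $D^j\Phi(z,s,a)$ means the termwise-differentiated series $\sum_{r\ge0} r^j z^r/(r+a)^s$ (absolutely convergent there). *)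

theory Defs
  imports "HOL-Analysis.Analysis" "HOL-Real_Asymp.Real_Asymp"
begin

definition aug_alpha :: "nat \<Rightarrow> real" where
  "aug_alpha k = 3 / 2 * 4 ^ k"

definition aug_beta :: "nat \<Rightarrow> real" where
  "aug_beta k = 3 / 2 * 2 ^ k"

text \<open>
  The \<open>k\<close>-augmented centered triangular number \<open>A(n,k)\<close>, meant for \<open>n \<ge> 1\<close>; the subtraction
  is on the reals, so that \<open>A(r+1,k) = \<alpha>\<^sub>k r^2 + \<beta>\<^sub>k r + 1\<close>.
\<close>
definition aug_tri :: "nat \<Rightarrow> nat \<Rightarrow> real" where
  "aug_tri n k = aug_alpha k * (real n - 1) ^ 2 + aug_beta k * (real n - 1) + 1"

text \<open>
  Complex \<open>powr\<close> is the principal power: \<open>w powr (- s) = exp (- s * Ln w)\<close> for \<open>w \<noteq> 0\<close>, with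
  \<open>- pi < Im (Ln w) \<le> pi\<close>.  The base \<open>of_nat r + a\<close> never vanishes when
  \<open>a \<notin> \<int>\<^sub>\<le>\<^sub>0\<close>.
\<close>
definition lerch_Phi :: "complex \<Rightarrow> complex \<Rightarrow> complex \<Rightarrow> complex" where
  "lerch_Phi z s a = (\<Sum>r. z ^ r * (of_nat r + a) powr (- s))"

definition aug_H_term :: "nat \<Rightarrow> complex \<Rightarrow> complex \<Rightarrow> complex \<Rightarrow> nat \<Rightarrow> complex" where
  "aug_H_term k z s a r = of_real (aug_tri (r + 1) k) * z ^ r * (of_nat r + a) powr (- s)"

definition aug_H :: "nat \<Rightarrow> complex \<Rightarrow> complex \<Rightarrow> complex \<Rightarrow> complex" where
  "aug_H k z s a = (\<Sum>r. aug_H_term k z s a r)"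

definition euler_op :: "(complex \<Rightarrow> complex) \<Rightarrow> complex \<Rightarrow> complex" where
  "euler_op f = (\<lambda>z. z * deriv f z)"

text \<open>
  \<open>D_Phi j z s a\<close> is \<open>D\<^sup>j \<Phi>(z,s,a)\<close>: inside the unit disc the iterated Euler operator in the
  variable \<open>z\<close>; otherwise (of interest only for \<open>|z| = 1\<close>) the termwise differentiated series.
\<close>
definition D_Phi :: "nat \<Rightarrow> complex \<Rightarrow> complex \<Rightarrow> complex \<Rightarrow> complex" where
  "D_Phi j z s a =
     (if norm z < 1 then (euler_op ^^ j) (\<lambda>w. lerch_Phi w s a) z
      else (\<Sum>r. of_nat r ^ j * z ^ r * (of_nat r + a) powr (- s)))"

lemma norm_aug_H_term_bigtheta:
  "(\<lambda>r. norm (aug_H_term k z s a r)) \<in> \<Theta>(\<lambda>r. norm z ^ r * real r powr (2 - Re s))"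
proof -
  have A: "(\<lambda>r. \<bar>aug_tri (r + 1) k\<bar>) \<in> \<Theta>(\<lambda>r. real r ^ 2)"
  proof -
    have "c > 0 \<Longrightarrow> (\<lambda>r. \<bar>c * real r ^ 2 + b * real r + 1\<bar>) \<in> \<Theta>(\<lambda>r. real r ^ 2)" for b c :: real
      by real_asymp
    from this[of "aug_alpha k" "aug_beta k"] show ?thesis
      by (simp add: aug_tri_def aug_alpha_def)
  qed
  have B: "(\<lambda>r. norm (of_nat r + a)) \<in> \<Theta>(\<lambda>r. real r)"
  proof (rule bigthetaI)
    have "norm (of_nat r + a) \<le> (1 + norm a) * real r" if "r \<ge> 1" for r
    proof -
      have "norm (of_nat r + a) \<le> real r + norm a" using norm_triangle_ineq[of "of_nat r" a] by simp
      moreover have "norm a * 1 \<le> norm a * real r" using that by (intro mult_left_mono) auto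
      ultimately show ?thesis by (simp add: algebra_simps)
    qed
    then show "(\<lambda>r. norm (of_nat r + a)) \<in> O(\<lambda>r. real r)"
      by (intro bigoI[of _ "1 + norm a"] eventually_sequentiallyI[of 1]) simp
    have "real r \<le> 2 * norm (of_nat r + a)" if "r \<ge> nat \<lceil>2 * norm a\<rceil>" for r
    proof -
      have "real r \<ge> 2 * norm a" using that by linarith
      then show ?thesis using norm_triangle_ineq4[of "of_nat r + a" a] by simp
    qed
    then show "(\<lambda>r. norm (of_nat r + a)) \<in> \<Omega>(\<lambda>r. real r)"
      unfolding bigomega_iff_bigo
      by (intro bigoI[of _ 2] eventually_sequentiallyI[of "nat \<lceil>2 * norm a\<rceil>"]) simp
  qed
  have C: "(\<lambda>r. exp (Im s * Arg (of_nat r + a))) \<in> \<Theta>(\<lambda>r. 1)"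
  proof (rule bigthetaI)
    have le: "\<bar>Im s * Arg (of_nat r + a)\<bar> \<le> \<bar>Im s\<bar> * pi" for r
      unfolding abs_mult using Arg_bounded[of "of_nat r + a"] by (intro mult_left_mono) auto
    show "(\<lambda>r. exp (Im s * Arg (of_nat r + a))) \<in> O(\<lambda>r. 1)"
      using le by (intro bigoI[of _ "exp (\<bar>Im s\<bar> * pi)"] always_eventually allI) (simp add: abs_le_iff)
    have "1 \<le> exp (\<bar>Im s\<bar> * pi) * exp (Im s * Arg (of_nat r + a))" for r
      using le[of r] unfolding exp_add[symmetric] by simp
    then show "(\<lambda>r. exp (Im s * Arg (of_nat r + a))) \<in> \<Omega>(\<lambda>r. 1)"
      unfolding bigomega_iff_bigo
      by (intro bigoI[of _ "exp (\<bar>Im s\<bar> * pi)"] always_eventually allI) simp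
  qed
  have "(\<lambda>r. \<bar>aug_tri (r + 1) k\<bar> * norm z ^ r *
          (norm (of_nat r + a) powr (- Re s) * exp (Im s * Arg (of_nat r + a))))
        \<in> \<Theta>(\<lambda>r. real r ^ 2 * norm z ^ r * (real r powr (- Re s) * 1))"
    by (intro landau_theta.mult A C bigtheta_powr[OF B, simplified] bigtheta_refl)
  also have "(\<lambda>r. real r ^ 2 * norm z ^ r * (real r powr (- Re s) * 1))
        \<in> \<Theta>(\<lambda>r. norm z ^ r * real r powr (2 - Re s))"
    by (intro bigthetaI_cong eventually_sequentiallyI[of 1])
       (simp add: powr_diff powr_minus field_simps)
  finally show ?thesis
    by (simp add: aug_H_term_def norm_mult norm_power norm_powr_complex)
qed

text \<open>The explicit region of absolute convergence of the series defining \<open>H\<^sub>k(z,s,a)\<close>.\<close>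
lemma abs_summable_aug_H_term_iff:
  "summable (\<lambda>r. norm (aug_H_term k z s a r)) \<longleftrightarrow> norm z < 1 \<or> norm z = 1 \<and> Re s > 3"
proof -
  define g where "g = (\<lambda>r. norm z ^ r * real r powr (2 - Re s))"
  have th: "(\<lambda>r. norm (aug_H_term k z s a r)) \<in> \<Theta>(g)"
    unfolding g_def by (rule norm_aug_H_term_bigtheta)
  have gnn: "norm (g r) = g r" for r by (simp add: g_def)
  have "summable (\<lambda>r. norm (aug_H_term k z s a r)) \<longleftrightarrow> summable g"
  proof
    assume "summable (\<lambda>r. norm (aug_H_term k z s a r))"
    then have "summable (\<lambda>r. norm (norm (aug_H_term k z s a r)))" by simp
    then show "summable g"
      by (rule summable_comparison_test_bigo) (rule bigtheta_sym[THEN iffD1, THEN bigthetaD1, OF th])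
  next
    assume "summable g"
    then have "summable (\<lambda>r. norm (g r))" unfolding gnn .
    then show "summable (\<lambda>r. norm (aug_H_term k z s a r))"
      by (rule summable_comparison_test_bigo) (rule bigthetaD1[OF th])
  qed
  also have "summable g \<longleftrightarrow> norm z < 1 \<or> norm z = 1 \<and> Re s > 3"
  proof -
    consider "z = 0" | "0 < norm z" "norm z < 1" | "norm z = 1" | "norm z > 1"
      by (cases "z = 0") (auto, linarith)
    then show ?thesis
    proof cases
      case 1
      then have "g = (\<lambda>r. 0)" by (auto simp: g_def fun_eq_iff power_0_left)
      with 1 show ?thesis by simp
    next
      case 2
      define c where "c = norm z"
      have c: "0 < c" "c < 1" using 2 by (auto simp: c_def)
      define d where "d = (1 + c) / 2"
      have d: "c < d" "d < 1" using c by (auto simp: d_def)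
      have "(\<lambda>r. c ^ r * real r powr (2 - Re s)) \<in> O(\<lambda>r. d ^ r)"
        using c d by real_asymp
      moreover have "summable (\<lambda>r. norm (d ^ r))"
        using c d by (simp add: norm_power)
      ultimately have "summable (\<lambda>r. c ^ r * real r powr (2 - Re s))"
        by (rule summable_comparison_test_bigo[rotated])
      then have "summable g" by (simp add: g_def c_def)
      with 2 show ?thesis by simp
    next
      case 3
      then show ?thesis unfolding g_def by (auto simp: summable_real_powr_iff)
    next
      case 4
      define c where "c = norm z"
      have "c > 1" using 4 by (simp add: c_def)
      then have "filterlim (\<lambda>r. c ^ r * real r powr (2 - Re s)) at_top sequentially"
        by real_asymp
      then have "\<not> g \<longlonglongrightarrow> 0"
        unfolding g_def c_def[symmetric]
        using not_tendsto_and_filterlim_at_infinity[OF trivial_limit_sequentially]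
              filterlim_at_top_imp_at_infinity by fast
      with 4 show ?thesis using summable_LIMSEQ_zero[of g] by auto
    qed
  qed
  finally show ?thesis .
qed

end

theory Submission
  imports Defs
begin

text \<open>
  On coefficients, the Euler operator \<open>D = z d/dz\<close> is multiplication by the index:
  \<open>D z^r = r z^r\<close>.  Hence \<open>\<alpha> D\<^sup>2 + \<beta> D + 1\<close> multiplies the \<open>r\<close>-th term of
  \<open>\<Phi>\<close> by \<open>\<alpha> r\<^sup>2 + \<beta> r + 1 = A(r+1,k)\<close>, which is exactly the weight in \<open>H\<^sub>k\<close>.

  Two analytic points make this rigorous.  First, inside the unit disc a power series may be
  differentiated term by term any number of times (\<open>funpow_euler_op_powser\<close>), so both branches of
  \<open>D_Phi\<close> are given by the same weighted series (\<open>D_Phi_eq_series\<close>).  Second, one must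
  be able to split the series of \<open>H\<^sub>k\<close> into its three parts.  Because \<open>\<alpha>\<close> and \<open>\<beta>\<close> are
  at least \<open>1\<close>, the weight \<open>A(r+1,k)\<close> dominates each of \<open>1\<close>, \<open>r\<close> and \<open>r\<^sup>2\<close>, so
  absolute convergence of \<open>H\<^sub>k\<close> passes to each part (\<open>summable_lerch_weighted\<close>).  This
  argument is uniform in \<open>z\<close> and treats the disc and its boundary circle alike.
\<close>

lemma aug_tri_Suc: "aug_tri (r + 1) k = aug_alpha k * real r ^ 2 + aug_beta k * real r + 1"
  by (simp add: aug_tri_def)

lemma power_le_aug_tri:
  assumes "j \<le> 2"
  shows "real r ^ j \<le> aug_tri (r + 1) k"
proof -
  have "1 \<le> aug_alpha k" "1 \<le> aug_beta k"
    using one_le_power[of "4::real" k] one_le_power[of "2::real" k]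
    unfolding aug_alpha_def aug_beta_def by linarith+
  then have "1 * real r ^ 2 + 1 * real r + 1 \<le> aug_tri (r + 1) k"
    unfolding aug_tri_Suc by (intro add_mono mult_right_mono) auto
  moreover have "real r ^ j \<le> real r ^ 2 + real r + 1"
  proof -
    consider "j = 0" | "j = 1" | "j = 2" using assms by linarith
    then show ?thesis by cases auto
  qed
  ultimately show ?thesis by linarith
qed

lemma summable_lerch_weighted:
  assumes "summable (\<lambda>r. norm (aug_H_term k z s a r))" "j \<le> 2"
  shows "summable (\<lambda>r. of_nat r ^ j * z ^ r * (of_nat r + a) powr (- s))"
proof (rule summable_comparison_test'[OF assms(1)])
  fix r :: nat
  have "real r ^ j \<le> \<bar>aug_tri (r + 1) k\<bar>"
    using power_le_aug_tri[OF assms(2), of r k] by linarith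
  then have "real r ^ j * norm (z ^ r * (of_nat r + a) powr (- s))
      \<le> \<bar>aug_tri (r + 1) k\<bar> * norm (z ^ r * (of_nat r + a) powr (- s))"
    by (rule mult_right_mono) simp
  then show "norm (of_nat r ^ j * z ^ r * (of_nat r + a) powr (- s)) \<le> norm (aug_H_term k z s a r)"
    by (simp add: aug_H_term_def norm_mult norm_power mult.assoc)
qed

lemma summable_lerch_Phi:
  fixes z :: complex
  assumes "norm z < 1"
  shows "summable (\<lambda>r. (of_nat r + a) powr (- s) * z ^ r)"
proof -
  \<comment> \<open>The choice of \<open>k\<close> is immaterial: inside the disc every \<open>H\<^sub>k\<close> converges absolutely.\<close>
  have "summable (\<lambda>r. norm (aug_H_term 0 z s a r))"
    using assms by (simp add: abs_summable_aug_H_term_iff)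
  from summable_lerch_weighted[OF this, of 0] show ?thesis by (simp add: mult.commute)
qed

text \<open>
  Term-by-term differentiation lowers every exponent by one; the factor \<open>z\<close> in \<open>D\<close> restores it,
  so that the result is again a power series on the same disc and the lemma can be iterated.
\<close>
lemma sums_euler_op_powser:
  fixes c :: "nat \<Rightarrow> complex"
  assumes "\<And>w. norm w < 1 \<Longrightarrow> summable (\<lambda>n. c n * w ^ n)" "norm z < 1"
  shows "(\<lambda>n. of_nat n * c n * z ^ n) sums euler_op (\<lambda>w. \<Sum>n. c n * w ^ n) z"
proof -
  have "((\<lambda>w. \<Sum>n. c n * w ^ n) has_field_derivative (\<Sum>n. diffs c n * z ^ n)) (at z)"
    using assms by (intro termdiffs_strong'[where K = 1]) auto
  then have der: "deriv (\<lambda>w. \<Sum>n. c n * w ^ n) z = (\<Sum>n. diffs c n * z ^ n)"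
    by (rule DERIV_imp_deriv)
  have "summable (\<lambda>n. diffs c n * z ^ n)"
    using assms by (intro termdiff_converges[where K = 1]) auto
  from sums_mult[OF diffs_equiv[OF this], of z]
  have "(\<lambda>n. z * (of_nat n * c n * z ^ (n - Suc 0))) sums euler_op (\<lambda>w. \<Sum>n. c n * w ^ n) z"
    by (simp add: euler_op_def der)
  moreover have "z * (of_nat n * c n * z ^ (n - Suc 0)) = of_nat n * c n * z ^ n" for n
    by (cases n) auto
  ultimately show ?thesis by simp
qed

text \<open>
  The derivative at a point sees only a neighbourhood, which is what allows the induction to run on
  functions that are known only inside the open disc.
\<close>
lemma euler_op_cong_disc:
  assumes "\<And>w. norm w < 1 \<Longrightarrow> f w = g w" "norm z < 1"
  shows "euler_op f z = euler_op g z"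
proof -
  have "eventually (\<lambda>w. w \<in> ball 0 1) (nhds z)"
    using assms(2) by (intro eventually_nhds_in_open) auto
  then have "eventually (\<lambda>w. f w = g w) (nhds z)"
    by eventually_elim (simp add: assms(1))
  then show ?thesis by (simp add: euler_op_def deriv_cong_ev)
qed

lemma funpow_euler_op_powser:
  fixes c :: "nat \<Rightarrow> complex"
  assumes "\<And>w. norm w < 1 \<Longrightarrow> summable (\<lambda>n. c n * w ^ n)" "norm z < 1"
  shows "(\<lambda>n. of_nat n ^ j * c n * z ^ n) sums (euler_op ^^ j) (\<lambda>w. \<Sum>n. c n * w ^ n) z"
  using assms(2)
proof (induction j arbitrary: z)
  case 0
  then show ?case using summable_sums[OF assms(1)] by simp
next
  case (Suc j)
  have "(\<lambda>n. of_nat n * (of_nat n ^ j * c n) * z ^ n)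
      sums euler_op (\<lambda>w. \<Sum>n. of_nat n ^ j * c n * w ^ n) z"
    using Suc.IH Suc.prems by (intro sums_euler_op_powser sums_summable) auto
  also have "euler_op (\<lambda>w. \<Sum>n. of_nat n ^ j * c n * w ^ n) z
      = euler_op ((euler_op ^^ j) (\<lambda>w. \<Sum>n. c n * w ^ n)) z"
    using Suc.IH Suc.prems by (intro euler_op_cong_disc) (simp_all add: sums_iff)
  finally show ?case by (simp add: mult.assoc)
qed

lemma D_Phi_eq_series:
  "D_Phi j z s a = (\<Sum>r. of_nat r ^ j * z ^ r * (of_nat r + a) powr (- s))"
proof (cases "norm z < 1")
  case True
  from sums_unique[OF funpow_euler_op_powser[where j = j, OF summable_lerch_Phi[of _ a s] this]]
  show ?thesis using True by (simp add: D_Phi_def lerch_Phi_def mult_ac)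
qed (simp add: D_Phi_def)

theorem proposition5p1:
  fixes k :: nat and a z s :: complex
  assumes "a \<notin> \<int>\<^sub>\<le>\<^sub>0"
    and "summable (\<lambda>r. norm (aug_H_term k z s a r))"
  shows "aug_H k z s a
       = of_real (aug_alpha k) * D_Phi 2 z s a + of_real (aug_beta k) * D_Phi 1 z s a + lerch_Phi z s a"
proof -
  define t where "t j r = of_nat r ^ j * z ^ r * (of_nat r + a) powr (- s)" for j r
  have t: "t j sums D_Phi j z s a" if "j \<le> 2" for j
    using summable_sums[OF summable_lerch_weighted[OF assms(2) that]]
    by (simp add: D_Phi_eq_series t_def[abs_def])
  have "D_Phi 0 z s a = lerch_Phi z s a"
    by (simp add: D_Phi_eq_series lerch_Phi_def)
  then have "(\<lambda>r. of_real (aug_alpha k) * t 2 r + of_real (aug_beta k) * t 1 r + t 0 r)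
      sums (of_real (aug_alpha k) * D_Phi 2 z s a + of_real (aug_beta k) * D_Phi 1 z s a
            + lerch_Phi z s a)"
    using t[of 0] by (intro sums_add sums_mult t) auto
  moreover have "of_real (aug_alpha k) * t 2 r + of_real (aug_beta k) * t 1 r + t 0 r
      = aug_H_term k z s a r" for r
    by (simp only: aug_H_term_def aug_tri_Suc) (simp add: t_def algebra_simps)
  ultimately show ?thesis by (simp add: aug_H_def sums_iff)
qed

end
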